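(* For coprime integers $q,n$ with $0<q<n/2$ write $n=bq+r$ with $0\le r<q$. The billiard strings of $D_2$ (square table) are in bijective correspondence with the $(n,q)$-binary strings $d\in\{0,1\}^\infty$ built from two kinds of blocks, of lengths $b$ and $b+1$, each consisting of a repeated digit, where adjacent blocks have opposite digits and the arrangement of the blocks follows from the orbit $0,-r,-2r,\dots \bmod q$: for $k\ge0$ the $k$-th block has length $b+1$ if the residue of $-kr$ modulo $q$ in $\{0,\dots,q-1\}$ is less than $r$, and length $b$ otherwise.
   Context: The square table is unfolded by reflection to an edge-labelled square tessellation of $\mathbb{R}^2$, and a billiard trajectory is unfolded to a ray $\tau$ in $\mathbb{R}^2$. Label the edges of the square $0,1,2,3$ and delete from the unfolded tessellation all edges with two of the labels, so that binary digits remain. There are linearly independent vectors $v_1,v_2$ generating the lattice of vertices, such that moving from one remaining edge to the next by a unit step in $v_2$ adds $0$ to the digit modulo $2$ and by a unit step in $v_1$ adds $1$ modulo $2$. By convention, the billiard strings of $D_2$ are the digit strings of nonsingular rays $\tau=\{p_0+tv_0:t\ge0\}$ with $v_0=n^{-1}(qv_1+(n-q)v_2)$, with $q,n$ coprime and $0<q<n/2$, and $p_0=av_1+(1-a)v_2$ with $a>0$ negligibly small, meaning $0<a<1/n$, starting on an edge with digit $0$. Nonsingular means that $\tau$ passes through no lattice vertex. The digit string of $\tau$ is $d=(d_0,d_1,\dots)$ with $d_k$ the label at $p_0+kv_0$, i.e. $d_k\equiv \lfloor a+kq/n\rfloor \pmod 2$. The $(n,q)$-binary strings start with the digit $0$.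 The correspondence pairs a ray's digit string with the $(n,q)$-binary string for the same $q,n$. *)

theory Defs
  imports "HOL-Analysis.Analysis"
begin

section \<open>The unfolded square table\<close>

type_synonym point = "real \<times> real"

definition corner :: "nat \<Rightarrow> point" where
  "corner l = [(0, 0), (1, 0), (1, 1), (0, 1)] ! (l mod 4)"

definition side :: "nat \<Rightarrow> point set" where
  "side l = closed_segment (corner l) (corner (Suc l))"

fun reflect :: "nat \<Rightarrow> point \<Rightarrow> point" where
  "reflect l (x, y) =
     [(x, - y), (2 - x, y), (x, 2 - y), (- x, y)] ! (l mod 4)"

text \<open>The mirror images \<open>g ` [0,1]\<^sup>2\<close> of the table: reflecting the copy given by \<open>g\<close>
  in its own side \<open>g ` side l\<close> yields the copy given by \<open>g \<circ> reflect l\<close>.\<close>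

inductive_set unfolding_maps :: "(point \<Rightarrow> point) set" where
  id: "(\<lambda>p. p) \<in> unfolding_maps"
| reflect: "g \<in> unfolding_maps \<Longrightarrow> g \<circ> reflect l \<in> unfolding_maps"

definition vertices :: "point set" where
  "vertices = {g (corner l) | g l. g \<in> unfolding_maps}"

definition labelled_edge :: "point set \<Rightarrow> nat \<Rightarrow> bool" where
  "labelled_edge E l \<longleftrightarrow> l < 4 \<and> (\<exists>g\<in>unfolding_maps. E = g ` side l)"

text \<open>The edges labelled \<open>1\<close> and \<open>3\<close> are deleted; the remaining labels \<open>0\<close> and \<open>2\<close> are
  written as the binary digits \<open>0\<close> and \<open>1\<close>. (A frame in the sense below can only exist if
  the two deleted labels belong to opposite sides.)\<close>

definition remaining_edge :: "point set \<Rightarrow> nat \<Rightarrow> bool" where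
  "remaining_edge E c \<longleftrightarrow> c < 2 \<and> labelled_edge E (2 * c)"

text \<open>The norm condition says that a unit step leads to the next remaining edge: along the
  same line for \<open>v\<^sub>2\<close>, on the opposite side of a square for \<open>v\<^sub>1\<close>. Without it the other
  conditions also admit \<open>v\<^sub>1 = (0, 1)\<close>, \<open>v\<^sub>2 = (1, 2)\<close>.\<close>

definition d2_frame :: "point \<Rightarrow> point \<Rightarrow> bool" where
  "d2_frame v1 v2 \<longleftrightarrow>
     v1 \<noteq> v2 \<and> independent {v1, v2} \<and> norm v1 = 1 \<and> norm v2 = 1 \<and>
     vertices = {of_int i *\<^sub>R v1 + of_int j *\<^sub>R v2 | i j. True} \<and>
     (\<forall>E c. remaining_edge E c \<longrightarrow>
        remaining_edge ((+) v2 ` E) c \<and> remaining_edge ((+) v1 ` E) ((c + 1) mod 2))"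

text \<open>The label at a point: the digit of the remaining edge from which the point is reached by
  less than one step in \<open>v\<^sub>1\<close>, the step which passes from one digit to the other. The points
  \<open>p\<^sub>0 + k v\<^sub>0\<close> below are not on remaining edges themselves; the starting point \<open>p\<^sub>0\<close> is
  the point \<open>(1 - a) v\<^sub>2\<close> of the edge from \<open>0\<close> to \<open>v\<^sub>2\<close>, which has digit \<open>0\<close>, moved by the
  negligible amount \<open>a v\<^sub>1\<close>. For \<open>p = s v\<^sub>1 + t v\<^sub>2\<close> it is the residue of
  \<open>\<lfloor>s\<rfloor>\<close> modulo \<open>2\<close>; see \<open>label_at_iff\<close>.\<close>

definition label_at :: "point \<Rightarrow> point \<Rightarrow> nat \<Rightarrow> bool" where
  "label_at v1 p c \<longleftrightarrow>
     (\<exists>E. remaining_edge E c \<and> (\<exists>x\<in>E. \<exists>s. 0 \<le> s \<and> s < 1 \<and> p = x + s *\<^sub>R v1))"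


section \<open>Billiard strings of the square table\<close>

definition admissible :: "int \<Rightarrow> int \<Rightarrow> bool" where
  "admissible q n \<longleftrightarrow> coprime q n \<and> 0 < q \<and> real_of_int q < real_of_int n / 2"

definition start_point :: "point \<Rightarrow> point \<Rightarrow> real \<Rightarrow> point" where
  "start_point v1 v2 a = a *\<^sub>R v1 + (1 - a) *\<^sub>R v2"

definition direction :: "point \<Rightarrow> point \<Rightarrow> int \<Rightarrow> int \<Rightarrow> point" where
  "direction v1 v2 q n =
     (1 / of_int n) *\<^sub>R (of_int q *\<^sub>R v1 + of_int (n - q) *\<^sub>R v2)"

definition ray :: "point \<Rightarrow> point \<Rightarrow> point set" where
  "ray p v = {p + t *\<^sub>R v | t. 0 \<le> t}"

definition nonsingular :: "point set \<Rightarrow> bool" where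
  "nonsingular \<tau> \<longleftrightarrow> \<tau> \<inter> vertices = {}"

definition digit_string :: "point \<Rightarrow> point \<Rightarrow> point \<Rightarrow> (nat \<Rightarrow> nat) \<Rightarrow> bool" where
  "digit_string v1 p v d \<longleftrightarrow> (\<forall>k. label_at v1 (p + of_nat k *\<^sub>R v) (d k))"

definition billiard_strings :: "point \<Rightarrow> point \<Rightarrow> int \<Rightarrow> int \<Rightarrow> (nat \<Rightarrow> nat) set" where
  "billiard_strings v1 v2 q n =
     {d. \<exists>a. 0 < a \<and> a < 1 / of_int n \<and>
           nonsingular (ray (start_point v1 v2 a) (direction v1 v2 q n)) \<and>
           label_at v1 (start_point v1 v2 a) 0 \<and>
           digit_string v1 (start_point v1 v2 a) (direction v1 v2 q n) d}"

definition all_billiard_strings :: "point \<Rightarrow> point \<Rightarrow> (nat \<Rightarrow> nat) set" where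
  "all_billiard_strings v1 v2 =
     {d. \<exists>q n. admissible q n \<and> d \<in> billiard_strings v1 v2 q n}"


section \<open>Binary strings built from blocks\<close>

definition block_length :: "int \<Rightarrow> int \<Rightarrow> nat \<Rightarrow> nat" where
  "block_length n q k =
     (let b = n div q; r = n mod q
      in if (- (int k * r)) mod q < r then nat b + 1 else nat b)"

text \<open>The \<open>k\<close>-th block of \<open>d\<close> occupies the positions \<open>s k, \<dots>, s (k + 1) - 1\<close> and consists
  of the digit \<open>c k\<close>.\<close>

definition binary_string :: "int \<Rightarrow> int \<Rightarrow> (nat \<Rightarrow> nat) \<Rightarrow> bool" where
  "binary_string n q d \<longleftrightarrow>
     (\<forall>i. d i \<in> {0, 1}) \<and> d 0 = 0 \<and>
     (\<exists>s c. s 0 = 0 \<and>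
        (\<forall>k. s (Suc k) = s k + block_length n q k \<and>
             (\<forall>i\<in>{s k..<s (Suc k)}. d i = c k) \<and>
             c k \<in> {0, 1} \<and> c (Suc k) \<noteq> c k))"

definition all_binary_strings :: "(nat \<Rightarrow> nat) set" where
  "all_binary_strings = {d. \<exists>q n. admissible q n \<and> binary_string n q d}"


section \<open>Existence of a frame, and the label in coordinates\<close>

lemma unfolding_maps_form:
  assumes "g \<in> unfolding_maps"
  shows "\<exists>i j :: int. \<exists>e\<in>{1, -1}. \<exists>f\<in>{1, -1}.
           g = (\<lambda>(x, y). (2 * of_int i + e * x, 2 * of_int j + f * y))"
  using assms
proof induction
  case id
  show ?case
    by (intro exI[of _ 0] bexI[of _ 1]) (auto simp: fun_eq_iff)
next
  case (reflect g l)
  then obtain i j :: int and e f :: real where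
    ef: "e \<in> {1, -1}" "f \<in> {1, -1}" and
    g: "g = (\<lambda>(x, y). (2 * of_int i + e * x, 2 * of_int j + f * y))"
    by blast
  have "l mod 4 < 4" by simp
  then consider "l mod 4 = 0" | "l mod 4 = 1" | "l mod 4 = 2" | "l mod 4 = 3"
    by linarith
  then show ?case
  proof cases
    case 1
    show ?thesis
      by (rule exI[of _ i], rule exI[of _ j], rule bexI[of _ e], rule bexI[of _ "- f"])
        (use ef 1 in \<open>auto simp: g fun_eq_iff\<close>)
  next
    case 2
    have "e = 1 \<or> e = -1" using ef by simp
    then obtain m :: int where m: "e = of_int m" by (metis of_int_1 of_int_minus)
    show ?thesis
      by (rule exI[of _ "i + m"], rule exI[of _ j], rule bexI[of _ "- e"], rule bexI[of _ f])
        (use ef 2 m in \<open>auto simp: g fun_eq_iff algebra_simps\<close>)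
  next
    case 3
    have "f = 1 \<or> f = -1" using ef by simp
    then obtain m :: int where m: "f = of_int m" by (metis of_int_1 of_int_minus)
    show ?thesis
      by (rule exI[of _ i], rule exI[of _ "j + m"], rule bexI[of _ e], rule bexI[of _ "- f"])
        (use ef 3 m in \<open>auto simp: g fun_eq_iff algebra_simps\<close>)
  next
    case 4
    show ?thesis
      by (rule exI[of _ i], rule exI[of _ j], rule bexI[of _ "- e"], rule bexI[of _ f])
        (use ef 4 in \<open>auto simp: g fun_eq_iff\<close>)
  qed
qed

lemma unfolding_maps_trans:
  assumes "g \<in> unfolding_maps" "h \<in> unfolding_maps"
  shows "g \<circ> h \<in> unfolding_maps"
  using assms(2)
proof induction
  case id
  show ?case using assms(1) by (simp add: comp_def)
next
  case (reflect h l)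
  then show ?case by (metis comp_assoc unfolding_maps.reflect)
qed

lemma reflect_in: "reflect l \<in> unfolding_maps"
  using unfolding_maps.reflect[OF unfolding_maps.id, of l] by (simp add: comp_def)

lemma shift_in: "(\<lambda>(x, y). (x + 2 * of_int i, y + 2 * of_int j)) \<in> unfolding_maps"
proof -
  have pos: "(\<lambda>(x, y). (x + 2 * of_nat m, y)) \<in> unfolding_maps"
    and neg: "(\<lambda>(x, y). (x - 2 * of_nat m, y)) \<in> unfolding_maps"
    and up: "(\<lambda>(x, y). (x, y + 2 * of_nat m)) \<in> unfolding_maps"
    and down: "(\<lambda>(x, y). (x, y - 2 * of_nat m)) \<in> unfolding_maps" for m
  proof (induction m)
    case 0
    { case 1 show ?case using unfolding_maps.id by (simp add: case_prod_unfold) }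
    { case 2 show ?case using unfolding_maps.id by (simp add: case_prod_unfold) }
    { case 3 show ?case using unfolding_maps.id by (simp add: case_prod_unfold) }
    { case 4 show ?case using unfolding_maps.id by (simp add: case_prod_unfold) }
  next
    case (Suc m)
    { case 1
      have "(\<lambda>(x, y). (x + 2 * of_nat (Suc m), y))
              = (\<lambda>(x, y). (x + 2 * of_nat m, y)) \<circ> (reflect 1 \<circ> reflect 3)"
        by (auto simp: fun_eq_iff)
      then show ?case using Suc(1) by (metis unfolding_maps_trans reflect_in) }
    { case 2
      have "(\<lambda>(x, y). (x - 2 * of_nat (Suc m), y))
              = (\<lambda>(x, y). (x - 2 * of_nat m, y)) \<circ> (reflect 3 \<circ> reflect 1)"
        by (auto simp: fun_eq_iff)
      then show ?case using Suc(2) by (metis unfolding_maps_trans reflect_in) }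
    { case 3
      have "(\<lambda>(x, y). (x, y + 2 * of_nat (Suc m)))
              = (\<lambda>(x, y). (x, y + 2 * of_nat m)) \<circ> (reflect 2 \<circ> reflect 0)"
        by (auto simp: fun_eq_iff)
      then show ?case using Suc(3) by (metis unfolding_maps_trans reflect_in) }
    { case 4
      have "(\<lambda>(x, y). (x, y - 2 * of_nat (Suc m)))
              = (\<lambda>(x, y). (x, y - 2 * of_nat m)) \<circ> (reflect 0 \<circ> reflect 2)"
        by (auto simp: fun_eq_iff)
      then show ?case using Suc(4) by (metis unfolding_maps_trans reflect_in) }
  qed
  have x: "(\<lambda>(x, y). (x + 2 * of_int i, y)) \<in> unfolding_maps"
    by (cases i rule: int_cases2) (use pos neg in auto)
  have y: "(\<lambda>(x, y). (x, y + 2 * of_int j)) \<in> unfolding_maps"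
    by (cases j rule: int_cases2) (use up down in auto)
  have "(\<lambda>(x :: real, y :: real). (x + 2 * of_int i, y + 2 * of_int j))
          = (\<lambda>(x, y). (x + 2 * of_int i, y)) \<circ> (\<lambda>(x, y). (x, y + 2 * of_int j))"
    by (auto simp: fun_eq_iff)
  then show ?thesis using unfolding_maps_trans[OF x y] by simp
qed

lemma corner_simps [simp]:
  "corner 0 = (0, 0)" "corner (Suc 0) = (1, 0)" "corner 2 = (1, 1)" "corner 3 = (0, 1)"
  by (simp_all add: corner_def)

lemma corner_range: "corner l \<in> {(0, 0), (1, 0), (1, 1), (0, 1)}"
proof -
  have "l mod 4 < 4" by simp
  then consider "l mod 4 = 0" | "l mod 4 = 1" | "l mod 4 = 2" | "l mod 4 = 3"
    by linarith
  then show ?thesis by cases (simp_all add: corner_def)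
qed

lemma vertices_eq: "vertices = {(of_int i, of_int j) | i j. True}"
proof (intro equalityI subsetI)
  fix p assume "p \<in> vertices"
  then obtain g l where g: "g \<in> unfolding_maps" and p: "p = g (corner l)"
    unfolding vertices_def by blast
  obtain i j :: int and e f :: real where
    ef: "e \<in> {1, -1}" "f \<in> {1, -1}" and
    g': "g = (\<lambda>(x, y). (2 * of_int i + e * x, 2 * of_int j + f * y))"
    using unfolding_maps_form[OF g] by blast
  obtain e' f' :: int where "e = of_int e'" "f = of_int f'"
    using ef by (metis insertE of_int_1 of_int_minus singletonD)
  moreover obtain u w :: int where "corner l = (of_int u, of_int w)"
    using corner_range[of l] by (metis insertE of_int_0 of_int_1 singletonD)
  ultimately have "p = (of_int (2 * i + e' * u), of_int (2 * j + f' * w))"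
    by (simp add: p g')
  then show "p \<in> {(of_int i, of_int j) | i j. True}" by blast
next
  fix p :: point assume "p \<in> {(of_int i, of_int j) | i j. True}"
  then obtain i j where p: "p = (of_int i, of_int j)" by blast
  define l :: nat where
    "l = (if even j then if even i then 0 else 1 else if even i then 3 else 2)"
  have "p = (\<lambda>(x, y). (x + 2 * of_int (i div 2), y + 2 * of_int (j div 2))) (corner l)"
    using p by (auto simp: l_def elim!: evenE oddE)
  then show "p \<in> vertices" unfolding vertices_def using shift_in by blast
qed

lemma side_0: "side 0 = {(x, 0) | x. 0 \<le> x \<and> x \<le> 1}"
  by (auto simp: side_def closed_segment_def) 

lemma side_2: "side 2 = {(x, 1) | x. 0 \<le> x \<and> x \<le> 1}"
proof -
  have "side 2 = closed_segment (0, 1) (1, 1)"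
    by (simp add: side_def closed_segment_commute flip: numeral_3_eq_3)
  then show ?thesis by (auto simp: closed_segment_def)
qed

definition horizontal_edge :: "int \<Rightarrow> int \<Rightarrow> point set" where
  "horizontal_edge i j = {(x, of_int j) | x. of_int i \<le> x \<and> x \<le> of_int i + 1}"

lemma side_even: "c < 2 \<Longrightarrow> side (2 * c) = horizontal_edge 0 (int c)"
proof -
  assume "c < 2"
  then consider "c = 0" | "c = 1" by linarith
  then show ?thesis
  proof cases
    case 1
    show ?thesis unfolding 1 mult_0_right side_0 horizontal_edge_def by simp
  next
    case 2
    show ?thesis unfolding 2 mult_1_right side_2 horizontal_edge_def by simp
  qed
qed

lemma image_horizontal_edge:
  fixes e f :: int
  assumes "e \<in> {1, -1}" "f \<in> {1, -1}"
  shows "(\<lambda>(x, y). (2 * of_int i + of_int e * x, 2 * of_int j + of_int f * y))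
           ` horizontal_edge 0 c
         = horizontal_edge (2 * i + (if e = 1 then 0 else -1)) (2 * j + f * c)"
    (is "?g ` _ = ?R")
proof (intro equalityI subsetI)
  fix p assume "p \<in> ?g ` horizontal_edge 0 c"
  then show "p \<in> ?R" using assms by (auto simp: horizontal_edge_def)
next
  fix p assume "p \<in> ?R"
  then obtain x where p: "p = (x, of_int (2 * j + f * c))"
    and x: "of_int (2 * i + (if e = 1 then 0 else -1)) \<le> x"
      "x \<le> of_int (2 * i + (if e = 1 then 0 else -1)) + 1"
    unfolding horizontal_edge_def by blast
  define x' where "x' = of_int e * (x - 2 * of_int i)"
  have "p = ?g (x', of_int c)" using assms(1) by (auto simp: p x'_def)
  moreover have "(x', of_int c) \<in> horizontal_edge 0 c"
    using assms(1) x by (auto simp: horizontal_edge_def x'_def split: if_splits)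
  ultimately show "p \<in> ?g ` horizontal_edge 0 c" by blast
qed

lemma remaining_edge_iff:
  "remaining_edge E c \<longleftrightarrow> (\<exists>i j. E = horizontal_edge i j \<and> c = nat (j mod 2))"
proof
  assume "remaining_edge E c"
  then obtain g where c: "c < 2" and g: "g \<in> unfolding_maps" and E: "E = g ` side (2 * c)"
    by (auto simp: remaining_edge_def labelled_edge_def)
  obtain i j :: int and e f :: real where
    ef: "e \<in> {1, -1}" "f \<in> {1, -1}" and
    g': "g = (\<lambda>(x, y). (2 * of_int i + e * x, 2 * of_int j + f * y))"
    using unfolding_maps_form[OF g] by blast
  obtain e' :: int where e': "e = of_int e'" "e' \<in> {1, -1}"
    using ef by (metis insertE insertI1 insertI2 of_int_1 of_int_minus singletonD)
  obtain f' :: int where f': "f = of_int f'" "f' \<in> {1, -1}"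
    using ef by (metis insertE insertI1 insertI2 of_int_1 of_int_minus singletonD)
  have E': "E = horizontal_edge (2 * i + (if e' = 1 then 0 else -1)) (2 * j + f' * int c)"
    unfolding E side_even[OF c] g' e'(1) f'(1) by (rule image_horizontal_edge[OF e'(2) f'(2)])
  have "c = 0 \<or> c = 1" using c by linarith
  then have "c = nat ((2 * j + f' * int c) mod 2)"
  proof
    assume "c = 1"
    moreover have "(2 * j + f') mod 2 = 1" using f'(2) by (elim insertE) (simp_all, presburger+)
    ultimately show ?thesis by simp
  qed simp
  with E' show "\<exists>i j. E = horizontal_edge i j \<and> c = nat (j mod 2)" by blast
next
  assume "\<exists>i j. E = horizontal_edge i j \<and> c = nat (j mod 2)"
  then obtain i j where E: "E = horizontal_edge i j" and c: "c = nat (j mod 2)" by blast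
  have c2: "c < 2" and cj: "int c = j mod 2" using c by auto
  define m where "m = j div 2"
  have j: "j = 2 * m + int c" unfolding m_def cj by simp
  have "\<exists>g\<in>unfolding_maps. E = g ` side (2 * c)"
  proof (cases "even i")
    case True
    then obtain l where l: "i = 2 * l" by blast
    have "(\<lambda>(x, y). (2 * of_int l + of_int 1 * x, 2 * of_int m + of_int 1 * y)) ` side (2 * c) = E"
      unfolding side_even[OF c2] by (subst image_horizontal_edge) (simp_all add: E j l)
    moreover have "(\<lambda>(x :: real, y :: real). (2 * of_int l + of_int 1 * x, 2 * of_int m + of_int 1 * y))
                     \<in> unfolding_maps"
      using shift_in[of l m] by (simp add: case_prod_unfold add.commute)
    ultimately show ?thesis by blast
  next
    case False
    then obtain l where l: "i = 2 * l - 1"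
      by (metis add_diff_cancel_right' diff_add_cancel even_plus_one_iff evenE)
    have "(\<lambda>(x, y). (2 * of_int l + of_int (-1) * x, 2 * of_int m + of_int 1 * y)) ` side (2 * c) = E"
      unfolding side_even[OF c2] by (subst image_horizontal_edge) (simp_all add: E j l)
    moreover have "(\<lambda>(x :: real, y :: real). (2 * of_int l + of_int (-1) * x, 2 * of_int m + of_int 1 * y))
        = (\<lambda>(x, y). (x + 2 * of_int l, y + 2 * of_int m)) \<circ> reflect 3"
      by (auto simp: fun_eq_iff)
    ultimately show ?thesis
      by (metis unfolding_maps_trans shift_in reflect_in)
  qed
  then show "remaining_edge E c"
    using c2 by (simp add: remaining_edge_def labelled_edge_def)
qed

lemma translate_horizontal_edge:
  "(+) (of_int k, of_int l) ` horizontal_edge i j = horizontal_edge (i + k) (j + l)"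
proof (intro equalityI subsetI)
  fix p assume "p \<in> horizontal_edge (i + k) (j + l)"
  then obtain x where p: "p = (x, of_int (j + l))"
    and x: "of_int (i + k) \<le> x" "x \<le> of_int (i + k) + 1"
    unfolding horizontal_edge_def by blast
  have "p = (of_int k, of_int l) + (x - of_int k, of_int j)" by (simp add: p)
  moreover have "(x - of_int k, of_int j) \<in> horizontal_edge i j"
    using x by (auto simp: horizontal_edge_def)
  ultimately show "p \<in> (+) (of_int k, of_int l) ` horizontal_edge i j" by blast
qed (auto simp: horizontal_edge_def)

lemma d2_frame_exists: "d2_frame (0, 1) (1, 0)"
  unfolding d2_frame_def
proof (intro conjI allI impI)
  show "independent {(0 :: real, 1 :: real), (1, 0)}"
    by (auto simp: independent_insert span_singleton zero_prod_def)
  show "vertices = {of_int i *\<^sub>R (0, 1) + of_int j *\<^sub>R (1, 0) | i j. True}"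
    by (auto simp: vertices_eq)
  fix E c assume "remaining_edge E c"
  then obtain i j where E: "E = horizontal_edge i j" and c: "c = nat (j mod 2)"
    by (auto simp: remaining_edge_iff)
  have "(+) (1, 0) ` E = horizontal_edge (i + 1) j"
    using translate_horizontal_edge[of 1 0 i j] by (simp add: E)
  then show "remaining_edge ((+) (1, 0) ` E) c" using c remaining_edge_iff by blast
  have "(+) (0, 1) ` E = horizontal_edge i (j + 1)"
    using translate_horizontal_edge[of 0 1 i j] by (simp add: E)
  moreover have "(c + 1) mod 2 = nat ((j + 1) mod 2)"
    unfolding c by (cases "even j") (simp_all add: odd_iff_mod_2_eq_one even_iff_mod_2_eq_zero
      mod_add_left_eq[symmetric, of j])
  ultimately show "remaining_edge ((+) (0, 1) ` E) ((c + 1) mod 2)"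
    using remaining_edge_iff by blast
qed (simp_all add: norm_prod_def)

lemma int_norm_1:
  assumes "norm (real_of_int x, real_of_int y) = 1"
  shows "(x, y) \<in> {(1, 0), (-1, 0), (0, 1), (0, -1)}"
proof -
  have "(real_of_int x)\<^sup>2 + (real_of_int y)\<^sup>2 = 1"
    using assms by (simp add: norm_prod_def)
  then have "real_of_int (x\<^sup>2 + y\<^sup>2) = real_of_int 1" by simp
  then have eq: "x\<^sup>2 + y\<^sup>2 = 1" by (simp only: of_int_eq_iff)
  have "x\<^sup>2 \<le> 1" "y\<^sup>2 \<le> 1" using eq zero_le_power2[of x] zero_le_power2[of y] by linarith+
  then have "\<bar>x\<bar> \<le> 1" "\<bar>y\<bar> \<le> 1" by (simp_all add: abs_square_le_1)
  then have "x \<in> {-1, 0, 1}" "y \<in> {-1, 0, 1}" by auto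
  then show ?thesis using eq by auto
qed

lemma horizontal_edge_eq_iff:
  "horizontal_edge i j = horizontal_edge k l \<longleftrightarrow> i = k \<and> j = l"
proof
  assume eq: "horizontal_edge i j = horizontal_edge k l"
  have "(of_int i, of_int j) \<in> horizontal_edge i j" "(of_int k, of_int l) \<in> horizontal_edge k l"
    by (simp_all add: horizontal_edge_def)
  then have "(of_int i, of_int j) \<in> horizontal_edge k l" "(of_int k, of_int l) \<in> horizontal_edge i j"
    by (simp_all only: eq)
  then show "i = k \<and> j = l" by (auto simp: horizontal_edge_def)
qed simp

lemma d2_frame_cases:
  assumes "d2_frame v1 v2"
  shows "v1 \<in> {(0, 1), (0, -1)}" and "v2 \<in> {(1, 0), (-1, 0)}"
proof -
  have vert: "vertices = {of_int i *\<^sub>R v1 + of_int j *\<^sub>R v2 | i j. True}"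
    and n: "norm v1 = 1" "norm v2 = 1"
    and step: "\<And>E c. remaining_edge E c \<Longrightarrow> remaining_edge ((+) v2 ` E) c"
      "\<And>E c. remaining_edge E c \<Longrightarrow> remaining_edge ((+) v1 ` E) ((c + 1) mod 2)"
    using assms unfolding d2_frame_def by blast+
  have "of_int 1 *\<^sub>R v1 + of_int 0 *\<^sub>R v2 \<in> vertices"
    "of_int 0 *\<^sub>R v1 + of_int 1 *\<^sub>R v2 \<in> vertices"
    unfolding vert by blast+
  then obtain x1 y1 x2 y2 :: int where
    v: "v1 = (of_int x1, of_int y1)" "v2 = (of_int x2, of_int y2)"
    by (auto simp: vertices_eq)
  have r0: "remaining_edge (horizontal_edge 0 0) 0"
    by (simp add: remaining_edge_iff horizontal_edge_eq_iff)
  have "remaining_edge (horizontal_edge x2 y2) 0"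
    using step(1)[OF r0] by (simp add: v translate_horizontal_edge)
  then have "even y2" by (auto simp: remaining_edge_iff horizontal_edge_eq_iff) presburger
  moreover have "remaining_edge (horizontal_edge x1 y1) 1"
    using step(2)[OF r0] by (simp add: v translate_horizontal_edge)
  then have "odd y1" by (auto simp: remaining_edge_iff horizontal_edge_eq_iff)
  moreover have "(x1, y1) \<in> {(1, 0), (-1, 0), (0, 1), (0, -1)}"
    "(x2, y2) \<in> {(1, 0), (-1, 0), (0, 1), (0, -1)}"
    using n v int_norm_1 by auto
  ultimately show "v1 \<in> {(0, 1), (0, -1)}" "v2 \<in> {(1, 0), (-1, 0)}"
    using v by auto
qed

lemma label_at_iff:
  assumes "d2_frame v1 v2"
  shows "label_at v1 (s *\<^sub>R v1 + t *\<^sub>R v2) c \<longleftrightarrow> int c = \<lfloor>s\<rfloor> mod 2"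
proof -
  obtain e f :: int where e: "e \<in> {1, -1}" and v1: "v1 = (0, of_int e)"
    and f: "f \<in> {1, -1}" and v2: "v2 = (of_int f, 0)"
    using d2_frame_cases[OF assms]
    by (metis insertE insertI1 insertI2 of_int_1 of_int_minus singletonD)
  have p: "s *\<^sub>R v1 + t *\<^sub>R v2 = (t * of_int f, s * of_int e)" by (simp add: v1 v2)
  show ?thesis
  proof
    assume "label_at v1 (s *\<^sub>R v1 + t *\<^sub>R v2) c"
    then obtain i j x u where c: "c = nat (j mod 2)"
      and u: "0 \<le> u" "u < 1" and eq: "(t * of_int f, s * of_int e) = (x, of_int j) + u *\<^sub>R v1"
      unfolding label_at_def remaining_edge_iff p by (auto simp: horizontal_edge_def)
    have "s * of_int e = of_int j + u * of_int e" using eq by (simp add: v1)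
    then have "s = of_int (e * j) + u" using e by (auto simp: algebra_simps)
    then have "\<lfloor>s\<rfloor> = e * j" using u unfolding floor_eq_iff by linarith
    moreover have "(e * j) mod 2 = j mod 2" using e by (auto, presburger)
    ultimately show "int c = \<lfloor>s\<rfloor> mod 2" using c by simp
  next
    assume c: "int c = \<lfloor>s\<rfloor> mod 2"
    let ?E = "horizontal_edge \<lfloor>t * of_int f\<rfloor> (e * \<lfloor>s\<rfloor>)"
    have "(e * \<lfloor>s\<rfloor>) mod 2 = \<lfloor>s\<rfloor> mod 2" using e by (auto, presburger)
    then have "int c = (e * \<lfloor>s\<rfloor>) mod 2" using c by simp
    then have "remaining_edge ?E c" unfolding remaining_edge_iff by (metis nat_int)
    moreover have "(t * of_int f, of_int (e * \<lfloor>s\<rfloor>)) \<in> ?E"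
      unfolding horizontal_edge_def by auto
    moreover have "(t * of_int f, s * of_int e)
        = (t * of_int f, of_int (e * \<lfloor>s\<rfloor>)) + frac s *\<^sub>R v1"
      using e by (auto simp: v1 frac_def)
    ultimately show "label_at v1 (s *\<^sub>R v1 + t *\<^sub>R v2) c"
      unfolding label_at_def p by (metis frac_ge_0 frac_lt_1)
  qed
qed

end

theory Submission
  imports Defs
begin

text \<open>The correspondence is the identity: for fixed admissible \<open>q, n\<close> both sets are the singleton
  consisting of one and the same string, \<open>d i \<equiv> \<lfloor>i q / n\<rfloor> (mod 2)\<close>.

  On the billiard side the string is \<open>\<lfloor>a + i q / n\<rfloor>\<close> modulo \<open>2\<close>. The fractional part of
  \<open>i q / n\<close> is at most \<open>(n - 1) / n\<close>, so an \<open>a\<close> between \<open>0\<close> and \<open>1 / n\<close> does not carry the sum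
  over an integer, and the string does not depend on \<open>a\<close>. The set is not empty because such rays
  never meet a vertex: the coordinates of a point of the ray with respect to \<open>v\<^sub>1\<close> and
  \<open>v\<^sub>2\<close> add up to \<open>1 + t\<close>, so a vertex forces an integral \<open>t\<close>,
  and then \<open>a n\<close> would be an integer strictly between \<open>0\<close> and \<open>1\<close> (\<open>nonsingular_small_offset\<close>).

  On the combinatorial side, \<open>\<lfloor>i q / n\<rfloor> = k\<close> holds exactly for \<open>i\<close> from \<open>\<lceil>k n / q\<rceil>\<close> up to, but
  not including, \<open>\<lceil>(k + 1) n / q\<rceil>\<close>. Writing \<open>n = b q + r\<close>, this interval has length \<open>b\<close> plus the
  growth of \<open>\<lceil>k r / q\<rceil>\<close> when \<open>k\<close> increases by one, and that growth is \<open>1\<close> precisely if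
  \<open>-k r\<close> modulo \<open>q\<close> is less than \<open>r\<close> (\<open>block_start_Suc\<close>). Hence the blocks prescribed by the orbit
  are the intervals on which \<open>\<lfloor>i q / n\<rfloor>\<close> is constant, and alternation starting with \<open>0\<close>
  gives the \<open>k\<close>-th block the digit \<open>k mod 2\<close> (\<open>binary_string_iff\<close>).\<close>

definition rotation_string :: "int \<Rightarrow> int \<Rightarrow> nat \<Rightarrow> nat" where
  "rotation_string n q i = nat ((int i * q div n) mod 2)"

text \<open>The integer \<open>\<lceil>k n / q\<rceil>\<close>, with the ceiling expressed by integer division.\<close>

definition block_start :: "int \<Rightarrow> int \<Rightarrow> nat \<Rightarrow> nat" where
  "block_start n q k = nat (- ((- (int k * n)) div q))"

lemma admissible_pos:
  assumes "admissible q n"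
  shows "0 < q" "0 < n"
  using assms unfolding admissible_def by linarith+

lemma le_div_iff_mult_le_int:
  fixes x y q :: int
  assumes "0 < q"
  shows "x \<le> y div q \<longleftrightarrow> x * q \<le> y"
proof
  assume "x \<le> y div q"
  then have "x * q \<le> y div q * q" using assms by simp
  also have "\<dots> \<le> y"
    using assms pos_mod_sign[of q y] div_mult_mod_eq[of y q] by linarith
  finally show "x * q \<le> y" .
next
  assume "x * q \<le> y"
  then have "x * q div q \<le> y div q" using assms by (rule zdiv_mono1)
  then show "x \<le> y div q" using assms by simp
qed

lemma int_block_start:
  assumes "0 < q" "0 < n"
  shows "int (block_start n q k) = - ((- (int k * n)) div q)"
proof -
  have "(- (int k * n)) div q \<le> 0 div q"
    using assms by (intro zdiv_mono1) auto
  then show ?thesis by (simp add: block_start_def)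
qed

lemma block_start_le_iff:
  assumes "0 < q" "0 < n"
  shows "block_start n q k \<le> i \<longleftrightarrow> int k \<le> int i * q div n"
proof -
  have "block_start n q k \<le> i \<longleftrightarrow> - int i \<le> (- (int k * n)) div q"
    using int_block_start[OF assms, of k] by linarith
  also have "\<dots> \<longleftrightarrow> int k * n \<le> int i * q"
    using le_div_iff_mult_le_int[OF assms(1)] by simp
  also have "\<dots> \<longleftrightarrow> int k \<le> int i * q div n"
    using le_div_iff_mult_le_int[OF assms(2)] by simp
  finally show ?thesis .
qed

lemma in_block_iff:
  assumes "0 < q" "0 < n"
  shows "i \<in> {block_start n q k..<block_start n q (Suc k)} \<longleftrightarrow> int k = int i * q div n"
  using block_start_le_iff[OF assms, of k i] block_start_le_iff[OF assms, of "Suc k" i] by auto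

text \<open>With \<open>- k r = D q + m\<close> and \<open>0 \<le> m < q\<close>, subtracting \<open>r < q\<close> once more lowers the quotient
  \<open>D\<close> by one exactly when \<open>m < r\<close>; this is the extra element of a long block.\<close>

lemma block_start_Suc:
  assumes "0 < q" "0 < n"
  shows "block_start n q (Suc k) = block_start n q k + block_length n q k"
proof -
  define b where "b = n div q"
  define r where "r = n mod q"
  define D where "D = (- (int k * r)) div q"
  define m where "m = (- (int k * r)) mod q"
  have n: "n = b * q + r" by (simp add: b_def r_def)
  have r: "0 \<le> r" "r < q" using assms by (simp_all add: r_def)
  have m: "0 \<le> m" "m < q" using assms by (simp_all add: m_def)
  have b: "0 \<le> b" using assms by (simp add: b_def pos_imp_zdiv_nonneg_iff)
  have kr: "- (int k * r) = D * q + m" by (simp add: D_def m_def)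
  have "(- (int k * n)) div q = D - int k * b"
    using kr m by (intro int_div_pos_eq[of _ _ _ m]) (simp_all add: n algebra_simps)
  moreover have "(- (int (Suc k) * n)) div q
      = D - int k * b - b - (if m < r then 1 else 0)"
  proof (cases "m < r")
    case True
    then show ?thesis
      using kr m r by (intro int_div_pos_eq[of _ _ _ "m - r + q"]) (simp_all add: n algebra_simps)
  next
    case False
    then show ?thesis
      using kr m r by (intro int_div_pos_eq[of _ _ _ "m - r"]) (simp_all add: n algebra_simps)
  qed
  moreover have "int (block_length n q k) = b + (if m < r then 1 else 0)"
    using b by (simp add: block_length_def Let_def b_def r_def m_def)
  ultimately have "int (block_start n q (Suc k)) = int (block_start n q k + block_length n q k)"
    using int_block_start[OF assms] by simp
  then show ?thesis by (simp only: of_nat_eq_iff)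
qed

text \<open>The prescribed lengths determine the block boundaries. Position \<open>0\<close> lies in the first
  block, so this block has the digit \<open>0\<close>, and alternation determines the digits of the others.
  As every position lies in a block, only one binary string is possible.\<close>

lemma binary_string_iff:
  assumes "0 < q" "0 < n"
  shows "binary_string n q d \<longleftrightarrow> d = rotation_string n q"
proof
  have rot: "rotation_string n q i = k mod 2" if "int k = int i * q div n" for i k
    unfolding rotation_string_def that[symmetric] by (simp add: nat_mod_distrib)
  have start: "block_start n q 0 = 0" by (simp add: block_start_def)
  {
    assume "binary_string n q d"
    then obtain s c where d0: "d 0 = 0" and s0: "s 0 = 0"
      and s: "\<And>k. s (Suc k) = s k + block_length n q k"
      and c: "\<And>k i. i \<in> {s k..<s (Suc k)} \<Longrightarrow> d i = c k"
      and bit: "\<And>k. c k \<in> {0, 1}" and alt: "\<And>k. c (Suc k) \<noteq> c k"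
      unfolding binary_string_def by blast
    have s_eq: "s k = block_start n q k" for k
      by (induction k) (simp_all add: s0 s start block_start_Suc[OF assms])
    have "0 \<in> {s 0..<s (Suc 0)}"
      unfolding s_eq in_block_iff[OF assms] by simp
    then have c0: "c 0 = 0" using c d0 by metis
    have c_eq: "c k = k mod 2" for k
    proof (induction k)
      case (Suc k)
      then show ?case using alt[of k] bit[of "Suc k"] bit[of k] by (auto simp: mod_Suc)
    qed (simp add: c0)
    show "d = rotation_string n q"
    proof
      fix i
      have "0 \<le> int i * q div n" using assms by (simp add: pos_imp_zdiv_nonneg_iff)
      then have k: "int (nat (int i * q div n)) = int i * q div n" by simp
      then have "i \<in> {s (nat (int i * q div n))..<s (Suc (nat (int i * q div n)))}"
        unfolding s_eq in_block_iff[OF assms] .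
      then show "d i = rotation_string n q i" using c c_eq rot[OF k] by metis
    qed
  }
  {
    assume d: "d = rotation_string n q"
    have "d i \<in> {0, 1}" for i
      by (auto simp: d rotation_string_def)
    moreover have "d 0 = 0" by (simp add: d rotation_string_def)
    moreover have "d i = k mod 2"
      if "i \<in> {block_start n q k..<block_start n q (Suc k)}" for i k
      using that rot unfolding d in_block_iff[OF assms] by blast
    moreover have "k mod 2 \<in> {0, 1}" "Suc k mod 2 \<noteq> k mod 2" for k :: nat
      by (auto simp: mod_Suc)
    ultimately show "binary_string n q d"
      unfolding binary_string_def
      using start block_start_Suc[OF assms]
      by (intro conjI exI[of _ "block_start n q"] exI[of _ "\<lambda>k. k mod 2"]) blast+
  }
qed

lemma start_point_plus_direction:
  assumes "n \<noteq> 0"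
  shows "start_point v1 v2 a + t *\<^sub>R direction v1 v2 q n
       = (a + t * of_int q / of_int n) *\<^sub>R v1
         + (1 - a + t * (1 - of_int q / of_int n)) *\<^sub>R v2"
  using assms
  by (cases v1; cases v2) (simp add: start_point_def direction_def field_simps)

lemma floor_add_small:
  fixes m n :: int
  assumes "0 < n" "0 < a" "a < 1 / real_of_int n"
  shows "\<lfloor>a + of_int m / of_int n\<rfloor> = m div n"
proof -
  have "a * of_int n < 1" using assms by (simp add: field_simps)
  have "real_of_int m = of_int (m div n) * of_int n + of_int (m mod n)"
    by (metis div_mult_mod_eq of_int_add of_int_mult)
  moreover have "0 \<le> m mod n" "m mod n \<le> n - 1"
    using assms(1) pos_mod_bound[of n m] by simp_all
  then have "0 \<le> real_of_int (m mod n)" "real_of_int (m mod n) \<le> of_int n - 1"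
    by linarith+
  ultimately show ?thesis
    using assms \<open>a * of_int n < 1\<close>
    unfolding floor_eq_iff by (simp add: field_simps)
qed

lemma label_at_ray:
  assumes "d2_frame v1 v2" "0 < n" "0 < a" "a < 1 / real_of_int n"
  shows "label_at v1 (start_point v1 v2 a + of_nat k *\<^sub>R direction v1 v2 q n) c
         \<longleftrightarrow> c = rotation_string n q k"
proof -
  have eq: "a + real k * of_int q / of_int n = a + of_int (int k * q) / of_int n"
    by simp
  have "label_at v1 (start_point v1 v2 a + of_nat k *\<^sub>R direction v1 v2 q n) c
        \<longleftrightarrow> int c = (int k * q div n) mod 2"
    using assms(2)
    by (simp only: start_point_plus_direction label_at_iff[OF assms(1)] eq
        floor_add_small[OF assms(2-4)] less_irrefl)
  then show ?thesis by (auto simp: rotation_string_def)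
qed

lemma nonsingular_small_offset:
  assumes "d2_frame v1 v2" "0 < n" "0 < a" "a < 1 / real_of_int n"
  shows "nonsingular (ray (start_point v1 v2 a) (direction v1 v2 q n))"
proof (rule ccontr)
  assume "\<not> ?thesis"
  then obtain t where
    "start_point v1 v2 a + t *\<^sub>R direction v1 v2 q n \<in> vertices"
    unfolding nonsingular_def ray_def by blast
  moreover have "vertices = {of_int i *\<^sub>R v1 + of_int j *\<^sub>R v2 | i j. True}"
    using assms(1) unfolding d2_frame_def by blast
  ultimately obtain i j :: int where
    "start_point v1 v2 a + t *\<^sub>R direction v1 v2 q n = of_int i *\<^sub>R v1 + of_int j *\<^sub>R v2"
    by blast
  then have vertex:
    "(a + t * of_int q / of_int n) *\<^sub>R v1 + (1 - a + t * (1 - of_int q / of_int n)) *\<^sub>R v2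
     = of_int i *\<^sub>R v1 + of_int j *\<^sub>R v2"
    using assms(2) by (simp only: start_point_plus_direction less_irrefl)
  have i: "a + t * of_int q / of_int n = of_int i"
    and j: "1 - a + t * (1 - of_int q / of_int n) = of_int j"
    using vertex d2_frame_cases[OF assms(1)] by auto
  have "t = of_int (i + j - 1)" using i j by (simp add: algebra_simps)
  moreover have "a * of_int n = of_int i * of_int n - t * of_int q"
    using i assms(2) by (simp add: field_simps)
  ultimately have "a * of_int n = of_int (i * n - (i + j - 1) * q)"
    by simp
  moreover have "0 < a * of_int n" "a * of_int n < 1"
    using assms by (simp_all add: field_simps)
  ultimately have "0 < i * n - (i + j - 1) * q" "i * n - (i + j - 1) * q < 1"
    by linarith+
  then show False by linarith
qed

lemma billiard_strings_eq:
  assumes "d2_frame v1 v2" "0 < n"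
  shows "billiard_strings v1 v2 q n = {rotation_string n q}"
proof (intro equalityI subsetI)
  fix d assume "d \<in> billiard_strings v1 v2 q n"
  then obtain a where "0 < a" "a < 1 / of_int n"
    and "digit_string v1 (start_point v1 v2 a) (direction v1 v2 q n) d"
    unfolding billiard_strings_def by blast
  then show "d \<in> {rotation_string n q}"
    using label_at_ray[OF assms] unfolding digit_string_def by blast
next
  fix d assume "d \<in> {rotation_string n q}"
  then have d: "d = rotation_string n q" by simp
  define a where "a = 1 / (2 * real_of_int n)"
  have a: "0 < a" "a < 1 / of_int n" using assms(2) by (simp_all add: a_def field_simps)
  have "digit_string v1 (start_point v1 v2 a) (direction v1 v2 q n) d"
    unfolding digit_string_def d using label_at_ray[OF assms a] by blast
  moreover have "label_at v1 (start_point v1 v2 a) 0"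
    using label_at_ray[OF assms a, of 0 q 0] by (simp add: rotation_string_def)
  ultimately show "d \<in> billiard_strings v1 v2 q n"
    unfolding billiard_strings_def using a nonsingular_small_offset[OF assms a] by blast
qed

theorem theorem5p2:
  fixes v1 v2 :: point
  assumes "d2_frame v1 v2"
  shows "\<exists>\<phi>. bij_betw \<phi> (all_billiard_strings v1 v2) all_binary_strings \<and>
           (\<forall>q n. admissible q n \<longrightarrow>
              bij_betw \<phi> (billiard_strings v1 v2 q n) {d. binary_string n q d}) \<and>
           (\<forall>d\<in>all_billiard_strings v1 v2. \<phi> d = d)"
proof -
  have eq: "billiard_strings v1 v2 q n = {d. binary_string n q d}" if "admissible q n" for q n
  proof -
    from admissible_pos[OF that] show ?thesis
      using billiard_strings_eq[OF assms] binary_string_iff by auto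
  qed
  then have "all_billiard_strings v1 v2 = all_binary_strings"
    unfolding all_billiard_strings_def all_binary_strings_def by blast
  then show ?thesis
    using eq by (intro exI[of _ id]) (simp add: bij_betw_id)
qed

end
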